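(* Let $D=(x_1,\dots,x_n)$ be a dataset, $\perp$ a placeholder value, and $p_1,\dots,p_n\in[0,1]$. Let $\mathcal{F}(D,\perp,\{p_i\}_{i=1}^n)$ be the diffusion of $D$. If a mechanism $\mathcal{M}$ (acting on length-$n$ datasets whose entries are data values or $\perp$) satisfies $\varepsilon$-DP under the bounded (change-one) neighboring relation, then the composite mechanism $\mathcal{M}^{\mathcal{F}}:=\mathcal{M}(\mathcal{F}(\cdot,\perp,\{p_i\}_{i=1}^n))$ satisfies $\boldsymbol{\varepsilon}$-PDP in the bounded PDP setting, where $\boldsymbol{\varepsilon}=(\varepsilon_1,\dots,\varepsilon_n)$ is given by $e^{\varepsilon_i}=1+p_i(e^{\varepsilon}-1)$.
   Context: Diffusion: $\mathcal{F}(D,\perp,\{p_i\})$ outputs a dataset $D_{\mathcal{F}}$ of the same length $n$ in which, independently for each $i$, the $i$-th entry is $x_i$ with probability $p_i$ and is replaced by $\perp$ with probability $1-p_i$. Bounded (change-one) $\varepsilon$-DP: $\Pr(\mathcal{M}(D)\in K)\le e^{\varepsilon}\Pr(\mathcal{M}(D')\in K)$ for all measurable $K$ and all $D,D'$ of the same length differing in exactly one entry. Bounded $\boldsymbol{\varepsilon}$-PDP: for every $i$, all $D,D'$ differing only in the $i$-th entry and all measurable $K$, $\Pr(\mathcal{M}(D)\in K)\le e^{\varepsilon_i}\Pr(\mathcal{M}(D')\in K)$. *)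

theory Defs
  imports "HOL-Probability.Probability"
begin

text \<open>
  A dataset of length \<open>n\<close> over the data universe \<open>X\<close> is an extensional function on \<open>{1..n}\<close>.
\<close>

definition datasets :: "nat \<Rightarrow> 'a set \<Rightarrow> (nat \<Rightarrow> 'a) set" where
  "datasets n X = {1..n} \<rightarrow>\<^sub>E X"

text \<open>
  The input space carries the discrete sigma-algebra, so a mechanism is any
  family of probability measures on \<open>N\<close>, with no regularity required in the dataset.
  Nothing is assumed about \<open>M D\<close> when \<open>D\<close> is not a dataset.
\<close>

definition mechanism :: "nat \<Rightarrow> 'a set \<Rightarrow> 'b measure \<Rightarrow> ((nat \<Rightarrow> 'a) \<Rightarrow> 'b measure) \<Rightarrow> bool" where
  "mechanism n X N M \<longleftrightarrow> M \<in> count_space (datasets n X) \<rightarrow>\<^sub>M prob_algebra N"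

definition bounded_dp ::
  "nat \<Rightarrow> 'a set \<Rightarrow> 'b measure \<Rightarrow> real \<Rightarrow> ((nat \<Rightarrow> 'a) \<Rightarrow> 'b measure) \<Rightarrow> bool" where
  "bounded_dp n X N \<epsilon> M \<longleftrightarrow>
     (\<forall>D \<in> datasets n X. \<forall>D' \<in> datasets n X. (\<exists>!i. i \<in> {1..n} \<and> D i \<noteq> D' i) \<longrightarrow>
        (\<forall>K \<in> sets N. measure (M D) K \<le> exp \<epsilon> * measure (M D') K))"

definition bounded_pdp ::
  "nat \<Rightarrow> 'a set \<Rightarrow> 'b measure \<Rightarrow> (nat \<Rightarrow> real) \<Rightarrow> ((nat \<Rightarrow> 'a) \<Rightarrow> 'b measure) \<Rightarrow> bool" where
  "bounded_pdp n X N \<epsilon> M \<longleftrightarrow>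
     (\<forall>i \<in> {1..n}. \<forall>D \<in> datasets n X. \<forall>D' \<in> datasets n X.
        D i \<noteq> D' i \<and> (\<forall>j \<in> {1..n} - {i}. D j = D' j) \<longrightarrow>
        (\<forall>K \<in> sets N. measure (M D) K \<le> exp (\<epsilon> i) * measure (M D') K))"

text \<open>
  \<open>Pi_pmf\<close> makes the entries independent; its default value \<open>undefined\<close> outside \<open>{1..n}\<close> is the
  one prescribed by extensionality.
\<close>

definition diffusion :: "nat \<Rightarrow> 'a \<Rightarrow> (nat \<Rightarrow> real) \<Rightarrow> (nat \<Rightarrow> 'a) \<Rightarrow> (nat \<Rightarrow> 'a) pmf" where
  "diffusion n b p D =
     Pi_pmf {1..n} undefined
       (\<lambda>i. map_pmf (\<lambda>keep. if keep then D i else b) (bernoulli_pmf (p i)))"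

text \<open>
  The output distribution of a mechanism fed with a random input drawn from \<open>P\<close>. Restricting to
  the support of \<open>P\<close> keeps the monadic bind well-defined although \<open>M\<close> is unspecified elsewhere;
  see \<open>measure_run_on\<close> below.
\<close>

definition run_on :: "('d \<Rightarrow> 'b measure) \<Rightarrow> 'd pmf \<Rightarrow> 'b measure" where
  "run_on M P = restrict_space (measure_pmf P) (set_pmf P) \<bind> M"

definition diffused ::
  "nat \<Rightarrow> 'a \<Rightarrow> (nat \<Rightarrow> real) \<Rightarrow> ((nat \<Rightarrow> 'a) \<Rightarrow> 'b measure) \<Rightarrow> (nat \<Rightarrow> 'a) \<Rightarrow> 'b measure" where
  "diffused n b p M = (\<lambda>D. run_on M (diffusion n b p D))"

lemma set_pmf_diffusion_subset:
  assumes "D \<in> datasets n X"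
  shows "set_pmf (diffusion n b p D) \<subseteq> datasets n (insert b X)"
  using assms set_Pi_pmf_subset'[of "{1..n}" undefined
      "\<lambda>i. map_pmf (\<lambda>keep. if keep then D i else b) (bernoulli_pmf (p i))"]
  unfolding diffusion_def datasets_def
  by (fastforce simp: PiE_dflt_def PiE_iff extensional_def split: if_splits)

lemma
  assumes M: "\<And>D. D \<in> set_pmf P \<Longrightarrow> M D \<in> space (prob_algebra N)"
  shows run_on_in_prob_algebra: "run_on M P \<in> space (prob_algebra N)"
    and measure_run_on:
      "K \<in> sets N \<Longrightarrow> measure (run_on M P) K = measure_pmf.expectation P (\<lambda>D. measure (M D) K)"
proof -
  let ?R = "restrict_space (measure_pmf P) (set_pmf P)"
  have sets_R: "sets ?R = sets (count_space (set_pmf P))"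
    by (auto simp: sets_restrict_space)
  have meas: "M \<in> ?R \<rightarrow>\<^sub>M prob_algebra N"
    unfolding measurable_cong_sets[OF sets_R refl] using M by simp
  have R: "prob_space ?R"
    by (intro prob_spaceI)
       (simp add: space_restrict_space emeasure_restrict_space measure_pmf.emeasure_eq_1_AE
          AE_measure_pmf)
  show "run_on M P \<in> space (prob_algebra N)"
    unfolding run_on_def using prob_space_bind'[OF _ meas] sets_bind'[OF _ meas] R
    by (auto simp: space_prob_algebra)
  assume K: "K \<in> sets N"
  have ne: "space ?R \<noteq> {}"
    using R prob_space.not_empty by blast
  interpret R: prob_space ?R by fact
  have "measure (run_on M P) K = (\<integral>D. measure (M D) K \<partial>?R)"
    unfolding run_on_def
    using measurable_prob_algebraD[OF meas] K by (intro R.measure_bind) auto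
  also have "\<dots> = measure_pmf.expectation P (\<lambda>D. measure (M D) K)"
    by (subst integral_restrict_space)
       (auto intro!: integral_cong_AE simp: AE_measure_pmf_iff)
  finally show "measure (run_on M P) K = measure_pmf.expectation P (\<lambda>D. measure (M D) K)" .
qed

lemma mechanism_diffused:
  assumes "mechanism n (insert b X) N M"
  shows "mechanism n X N (diffused n b p M)"
  using assms set_pmf_diffusion_subset[of _ n X b p] unfolding mechanism_def diffused_def
  by (auto intro!: run_on_in_prob_algebra)

end

theory Submission
  imports Defs
begin

text \<open>
  Condition on the random entries other than the \<open>i\<close>-th. The \<open>i\<close>-th entry is then \<open>x\<^sub>i\<close> or \<open>\<bottom>\<close>, so
  with \<open>a\<close>, \<open>a'\<close> and \<open>c\<close> the probabilities of \<open>K\<close> when it is \<open>x\<^sub>i\<close>, \<open>x\<^sub>i'\<close> and \<open>\<bottom>\<close>, the claim is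
  \<open>p a + (1 - p) c \<le> (1 + p (e\<^sup>\<epsilon> - 1)) (p a' + (1 - p) c)\<close>. It holds because
  \<open>a - a' \<le> (e\<^sup>\<epsilon> - 1) min a' c\<close>. The placeholder \<open>\<bottom>\<close> is an ordinary value, so replacing
  \<open>x\<^sub>i\<close> by it is a legal neighbouring move.
\<close>

lemma mixture_ratio_le:
  fixes a a' c e p :: real
  assumes p: "0 \<le> p" "p \<le> 1" and e: "1 \<le> e" and a: "a \<le> e * a'" "a \<le> e * c"
  shows "p * a + (1 - p) * c \<le> (1 + p * (e - 1)) * (p * a' + (1 - p) * c)"
proof -
  let ?m = "min a' c"
  \<comment> \<open>If \<open>c \<le> a'\<close>, then \<open>a - a' \<le> e * c - c\<close>;
    otherwise the bound against \<open>a'\<close> suffices.\<close>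
  have "a - a' \<le> (e - 1) * ?m"
    using a by (auto simp: min_def algebra_simps)
  \<comment> \<open>Splitting the minimum with the mixture weights allows a termwise comparison with
    \<open>a'\<close> and \<open>c\<close>.\<close>
  also have "?m = p * ?m + (1 - p) * ?m"
    by (simp add: algebra_simps)
  also have "(e - 1) * \<dots> \<le> (e - 1) * (p * a' + (1 - p) * c)"
    using p e by (intro mult_left_mono add_mono) auto
  finally have "p * (a - a') \<le> p * ((e - 1) * (p * a' + (1 - p) * c))"
    using p by (intro mult_left_mono) auto
  then show ?thesis
    by (simp add: algebra_simps)
qed

text \<open>Position \<open>i\<close> holds only the default value, to be overwritten by an update
  \<open>E(i := v)\<close>.\<close>

definition rest_diffusion ::
  "nat \<Rightarrow> 'a \<Rightarrow> (nat \<Rightarrow> real) \<Rightarrow> nat \<Rightarrow> (nat \<Rightarrow> 'a) \<Rightarrow> (nat \<Rightarrow> 'a) pmf" where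
  "rest_diffusion n b p i D =
     Pi_pmf ({1..n} - {i}) undefined
       (\<lambda>j. map_pmf (\<lambda>keep. if keep then D j else b) (bernoulli_pmf (p j)))"

text \<open>Finite support makes every real function integrable, so expectations split with no bound
  on the integrand.\<close>

lemma finite_set_rest_diffusion: "finite (set_pmf (rest_diffusion n b p i D))"
  by (simp add: rest_diffusion_def set_Pi_pmf finite_PiE_dflt)

lemma fun_upd_rest_diffusion_in_datasets:
  assumes "D \<in> datasets n X" "b \<in> X" "v \<in> X" "i \<in> {1..n}"
    and "E \<in> set_pmf (rest_diffusion n b p i D)"
  shows "E(i := v) \<in> datasets n X"
  using assms set_Pi_pmf_subset'[of "{1..n} - {i}" undefined
      "\<lambda>j. map_pmf (\<lambda>keep. if keep then D j else b) (bernoulli_pmf (p j))"]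
  unfolding datasets_def rest_diffusion_def
  by (fastforce simp: PiE_dflt_def PiE_iff extensional_def split: if_splits)

text \<open>By independence, the coin of entry \<open>i\<close> can be tossed separately from the
  rest and averaged out.\<close>

lemma expectation_diffusion:
  fixes g :: "(nat \<Rightarrow> 'a) \<Rightarrow> real"
  assumes i: "i \<in> {1..n}" and p: "p i \<in> {0..1}"
  shows "measure_pmf.expectation (diffusion n b p D) g =
    measure_pmf.expectation (rest_diffusion n b p i D)
      (\<lambda>E. p i * g (E(i := D i)) + (1 - p i) * g (E(i := b)))"
proof -
  let ?R = "rest_diffusion n b p i D"
  have "diffusion n b p D = bernoulli_pmf (p i) \<bind>
      (\<lambda>keep. map_pmf (\<lambda>E. E(i := if keep then D i else b)) ?R)"
    using i Pi_pmf_insert'[of "{1..n} - {i}" i undefined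
      "\<lambda>j. map_pmf (\<lambda>keep. if keep then D j else b) (bernoulli_pmf (p j))"]
    by (simp add: diffusion_def rest_diffusion_def insert_absorb map_pmf_def bind_assoc_pmf bind_return_pmf)
  then have "measure_pmf.expectation (diffusion n b p D) g =
      p i * measure_pmf.expectation ?R (\<lambda>E. g (E(i := D i))) +
      (1 - p i) * measure_pmf.expectation ?R (\<lambda>E. g (E(i := b)))"
    using p by (simp add: pmf_expectation_bind[OF finite_class.finite_UNIV _ subset_UNIV]
        UNIV_bool finite_set_rest_diffusion)
  then show ?thesis
    by (simp add: integrable_measure_pmf_finite finite_set_rest_diffusion)
qed

lemma bounded_dp_fun_upd:
  assumes dp: "bounded_dp n X N \<epsilon> M" and i: "i \<in> {1..n}" and K: "K \<in> sets N"
    and E: "E(i := v) \<in> datasets n X" "E(i := w) \<in> datasets n X" and "v \<noteq> w"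
  shows "measure (M (E(i := v))) K \<le> exp \<epsilon> * measure (M (E(i := w))) K"
proof -
  have "\<exists>!j. j \<in> {1..n} \<and> (E(i := v)) j \<noteq> (E(i := w)) j"
    using i \<open>v \<noteq> w\<close> by (intro ex1I[of _ i]) (auto split: if_splits)
  then show ?thesis
    using dp E K unfolding bounded_dp_def by blast
qed

text \<open>\<open>\<epsilon>\<close> may be negative only if there are no neighbouring datasets: take \<open>K\<close> to be the whole space.\<close>

lemma bounded_dp_one_le_exp:
  assumes dp: "bounded_dp n X N \<epsilon> M" and mech: "mechanism n X N M"
    and D: "D \<in> datasets n X" "D' \<in> datasets n X" and neq: "\<exists>!i. i \<in> {1..n} \<and> D i \<noteq> D' i"
  shows "1 \<le> exp \<epsilon>"
proof -
  have total: "measure (M F) (space N) = 1" if "F \<in> datasets n X" for F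
  proof -
    have "M F \<in> space (prob_algebra N)"
      using mech that unfolding mechanism_def by (auto dest: measurable_space)
    then show ?thesis
      using sets_eq_imp_space_eq[of "M F" N] prob_space.prob_space[of "M F"]
      by (simp add: space_prob_algebra)
  qed
  have "measure (M D) (space N) \<le> exp \<epsilon> * measure (M D') (space N)"
    using dp D neq unfolding bounded_dp_def by blast
  then show ?thesis
    using total D by simp
qed

lemma measure_diffused:
  assumes "mechanism n (insert b X) N M" "D \<in> datasets n X" "K \<in> sets N"
  shows "measure (diffused n b p M D) K =
    measure_pmf.expectation (diffusion n b p D) (\<lambda>E. measure (M E) K)"
  unfolding diffused_def
  using assms set_pmf_diffusion_subset[OF assms(2), of b p]
  by (intro measure_run_on) (auto simp: mechanism_def dest: measurable_space)

theorem theorem6: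
  fixes n :: nat
    and X :: "'a set"
    and b :: 'a
    and p :: "nat \<Rightarrow> real"
    and N :: "'b measure"
    and M :: "(nat \<Rightarrow> 'a) \<Rightarrow> 'b measure"
    and \<epsilon> :: real
    and \<epsilon>s :: "nat \<Rightarrow> real"
  assumes "\<And>i. i \<in> {1..n} \<Longrightarrow> p i \<in> {0..1}"
    and "mechanism n (insert b X) N M"
    and "bounded_dp n (insert b X) N \<epsilon> M"
    and "\<And>i. i \<in> {1..n} \<Longrightarrow> exp (\<epsilon>s i) = 1 + p i * (exp \<epsilon> - 1)"
  shows "bounded_pdp n X N \<epsilon>s (diffused n b p M)"
proof -
  have main: "measure (diffused n b p M D) K \<le> exp (\<epsilon>s i) * measure (diffused n b p M D') K"
    if i: "i \<in> {1..n}" and D: "D \<in> datasets n X" and D': "D' \<in> datasets n X"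
      and neq: "D i \<noteq> D' i" and eq: "\<forall>j \<in> {1..n} - {i}. D j = D' j" and K: "K \<in> sets N"
    for i D D' K
  proof -
    let ?R = "rest_diffusion n b p i D"
    let ?m = "\<lambda>E v. measure (M (E(i := v))) K"
    \<comment> \<open>Entry \<open>i\<close> does not enter this law, so both neighbours are
      averaged over the same \<open>E\<close>.\<close>
    have R': "rest_diffusion n b p i D' = ?R"
      unfolding rest_diffusion_def using eq by (intro Pi_pmf_cong) (auto cong: if_cong)
    have D_ins: "D \<in> datasets n (insert b X)" "D' \<in> datasets n (insert b X)"
      using D D' by (auto simp: datasets_def PiE_iff)
    have vals: "D i \<in> insert b X" "D' i \<in> insert b X"
      using D_ins i by (auto simp: datasets_def)
    \<comment> \<open>\<open>D\<close> and \<open>D'\<close> are themselves neighbours, which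
      excludes a negative \<epsilon>.\<close>
    have "\<exists>!j. j \<in> {1..n} \<and> D j \<noteq> D' j"
      using i neq eq by (intro ex1I[of _ i]) auto
    with assms(2,3) D_ins have e: "1 \<le> exp \<epsilon>"
      by (intro bounded_dp_one_le_exp)
    have pointwise: "p i * ?m E (D i) + (1 - p i) * ?m E b
        \<le> exp (\<epsilon>s i) * (p i * ?m E (D' i) + (1 - p i) * ?m E b)"
      if "E \<in> set_pmf ?R" for E
    proof -
      have upd: "E(i := v) \<in> datasets n (insert b X)" if "v \<in> insert b X" for v
        using fun_upd_rest_diffusion_in_datasets[OF D_ins(1) _ that i \<open>E \<in> set_pmf ?R\<close>] by simp
      have "?m E (D i) \<le> exp \<epsilon> * ?m E (D' i)"
        using bounded_dp_fun_upd[OF assms(3) i K] upd vals neq by simp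
      moreover have "?m E (D i) \<le> exp \<epsilon> * ?m E b"
      \<comment> \<open>If \<open>D i = b\<close>, the two updates coincide and are not neighbours;
        the bound then comes from \<open>1 \<le> exp \<epsilon>\<close>.\<close>
      proof (cases "D i = b")
        case True
        then show ?thesis
          using mult_right_mono[OF e measure_nonneg] by simp
      next
        case False
        then show ?thesis
          using bounded_dp_fun_upd[OF assms(3) i K] upd vals by simp
      qed
      ultimately show ?thesis
        using assms(1)[OF i] e unfolding assms(4)[OF i] by (intro mixture_ratio_le) auto
    qed
    have "measure (diffused n b p M D) K =
        measure_pmf.expectation ?R (\<lambda>E. p i * ?m E (D i) + (1 - p i) * ?m E b)"
      using i by (simp only: measure_diffused[OF assms(2) D K] expectation_diffusion assms(1))
    also have "\<dots> \<le> measure_pmf.expectation ?R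
        (\<lambda>E. exp (\<epsilon>s i) * (p i * ?m E (D' i) + (1 - p i) * ?m E b))"
      using pointwise
      by (intro integral_mono_AE integrable_measure_pmf_finite finite_set_rest_diffusion)
         (simp add: AE_measure_pmf_iff)
    also have "\<dots> = exp (\<epsilon>s i) * measure (diffused n b p M D') K"
      using i by (simp only: measure_diffused[OF assms(2) D' K] expectation_diffusion assms(1) R'
        integral_mult_right_zero)
    finally show ?thesis .
  qed
  then show ?thesis
    unfolding bounded_pdp_def by blast
qed

end
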